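(* Assume the weak approximation property holds with constant $\eta_w>0$: for every $\mathbf v\in\mathbb R^n$ there is $\mathbf v_c\in\mathbb R^{n_c}$ with $\|\mathbf v-P\mathbf v_c\|_D\le\eta_w\|\mathbf v\|_A$. Let $\nu\ge1$ and let $\widetilde P=(I-\widetilde\pi_f)P$ be defined with the smoothed-aggregation polynomial $p_\nu$. Then there is a constant $\eta_s\le\|D\|\,\|D^{-1}\|\,\eta_w^2$ such that for every $\mathbf u\in\mathbb R^n$, with $\widetilde{\mathbf u}_c\in\mathbb R^{n_c}$ the solution of $\widetilde P^TA\widetilde P\,\widetilde{\mathbf u}_c=\widetilde P^TA\mathbf u$, $$\|A\|^{\frac12}\|\mathbf u-\widetilde P\widetilde{\mathbf u}_c\|_A\le\|D\|^{\frac12}\|\mathbf u-\widetilde P\widetilde{\mathbf u}_c\|_A\le\eta_s^{\frac12}\|A\mathbf u\|+\frac{\eta_w^2\|D\|^{\frac12}}{2\nu+1}\|\mathbf u\|_A.$$ In particular, if $D$ is well-conditioned, meaning $\|D\|\,\|D^{-1}\|\le K$, then $\eta_s\le K\eta_w^2$.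
   Context: $A\in\mathbb R^{n\times n}$ is symmetric positive definite (SPD), and $D\in\mathbb R^{n\times n}$ is a diagonal SPD matrix with $\mathbf v^TA\mathbf v\le\mathbf v^TD\mathbf v$ for all $\mathbf v\in\mathbb R^n$. For an SPD matrix $B$, $\|\mathbf v\|_B=\sqrt{\mathbf v^TB\mathbf v}$; $\|\cdot\|$ is the Euclidean norm for vectors and the spectral norm for matrices. The index set $\{1,\dots,n\}$ is partitioned into nonoverlapping aggregates $\mathcal A_1,\dots,\mathcal A_{n_a}$. The prolongation $P\in\mathbb R^{n\times n_c}$, of full column rank with $1\le n_c<n$, is block diagonal with respect to this partition, with blocks $P_{\mathcal A_i}$ (rows indexed by $\mathcal A_i$). On each aggregate, let $D_{\mathcal A_i}=D|_{\mathcal A_i}$ and choose vectors that are orthonormal with respect to $D_{\mathcal A_i}$ and span the $D_{\mathcal A_i}$-orthogonal complement of $\operatorname{Range}(P_{\mathcal A_i})$. Extended by zero outside $\mathcal A_i$, these vectors (for all $i$) are the columns of $P_\perp\in\mathbb R^{n\times(n-n_c)}$. Thus $P_\perp^TDP=0$ and $P_\perp^TDP_\perp=I$. Define $A_f=P_\perp^TAP_\perp$. The smoothed-aggregation (SA) polynomial of degree $\nu$ is $p_\nu(t)=\frac{(-1)^\nu}{2\nu+1}\frac{T_{2\nu+1}(\sqrt t)}{\sqrt t}$, where $T_k$ is the Chebyshev polynomial of the first kind of degree $k$; it satisfies $p_\nu(0)=1$. Write $p_\nu(t)=1-t\,q_{\nu-1}(t)$ with $q_{\nu-1}$ a polynomial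 of degree $\nu-1$, and set $\widetilde A_f^{-1}:=q_{\nu-1}(A_f)$ and $\widetilde\pi_f:=P_\perp\widetilde A_f^{-1}P_\perp^TA$. *)

theory Defs
  imports
    "HOL-Analysis.Analysis"
    "HOL-Library.Disjoint_Sets"
    "HOL-Computational_Algebra.Polynomial"
begin

subsection \<open>Matrices and norms\<close>

definition spd :: "real^'n^'n \<Rightarrow> bool" where
  "spd B \<longleftrightarrow> transpose B = B \<and> (\<forall>v. v \<noteq> 0 \<longrightarrow> 0 < v \<bullet> (B *v v))"

definition diagonal_matrix :: "real^'n^'n \<Rightarrow> bool" where
  "diagonal_matrix B \<longleftrightarrow> (\<forall>i j. i \<noteq> j \<longrightarrow> B $ i $ j = 0)"

definition energy_norm :: "real^'n^'n \<Rightarrow> real^'n \<Rightarrow> real" where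
  "energy_norm B v = sqrt (v \<bullet> (B *v v))"

text \<open>The library's \<open>norm\<close> on \<open>real^'n^'m\<close> is the Frobenius norm, not the spectral norm.\<close>

definition spectral_norm :: "real^'n^'m \<Rightarrow> real" where
  "spectral_norm B = onorm ((*v) B)"

text \<open>On \<open>real^'n^'n\<close> the operations \<open>*\<close> and \<open>^\<close> act entrywise, hence a separate power.\<close>

primrec matrix_power :: "real^'n^'n \<Rightarrow> nat \<Rightarrow> real^'n^'n" where
  "matrix_power B 0 = mat 1"
| "matrix_power B (Suc k) = B ** matrix_power B k"

definition matrix_poly :: "real poly \<Rightarrow> real^'n^'n \<Rightarrow> real^'n^'n" where
  "matrix_poly q B = (\<Sum>k\<le>degree q. coeff q k *\<^sub>R matrix_power B k)"


subsection \<open>Aggregates and block structure\<close>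

text \<open>
  The block of \<open>B\<close> with rows in \<open>R\<close> and columns in \<open>C\<close>, extended by zero: \<open>\<real>\<^sup>S\<close> for an
  aggregate \<open>S\<close> is identified with the vectors of \<open>\<real>\<^sup>n\<close> that vanish outside \<open>S\<close>.
\<close>

definition matrix_block :: "'m set \<Rightarrow> 'n set \<Rightarrow> real^'n^'m \<Rightarrow> real^'n^'m" where
  "matrix_block R C B = (\<chi> i j. if i \<in> R \<and> j \<in> C then B $ i $ j else 0)"

text \<open>
  The map \<open>c\<close> assigns to each column the aggregate whose diagonal block contains it, so the block
  of \<open>P\<close> on the aggregate \<open>S\<close> is \<open>matrix_block S {j. c j = S} P\<close>.
\<close>

definition block_diagonal :: "'n set set \<Rightarrow> ('c \<Rightarrow> 'n set) \<Rightarrow> real^'c^'n \<Rightarrow> bool" where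
  "block_diagonal \<A> c P \<longleftrightarrow> (\<forall>j. c j \<in> \<A>) \<and> (\<forall>i j. i \<notin> c j \<longrightarrow> P $ i $ j = 0)"

definition local_complement ::
    "real^'n^'n \<Rightarrow> ('c \<Rightarrow> 'n set) \<Rightarrow> real^'c^'n \<Rightarrow> 'n set \<Rightarrow> (real^'n) set" where
  "local_complement D c P S =
     {v. (\<forall>i. i \<notin> S \<longrightarrow> v $ i = 0) \<and>
         (\<forall>w \<in> range ((*v) (matrix_block S {j. c j = S} P)). v \<bullet> (matrix_block S S D *v w) = 0)}"

definition local_complement_basis ::
    "'n set set \<Rightarrow> real^'n^'n \<Rightarrow> ('c \<Rightarrow> 'n set) \<Rightarrow> real^'c^'n \<Rightarrow> ('f \<Rightarrow> 'n set) \<Rightarrow> real^'f^'n \<Rightarrow> bool"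
  where
  "local_complement_basis \<A> D c P f Q \<longleftrightarrow>
     block_diagonal \<A> f Q \<and>
     (\<forall>S\<in>\<A>.
        (\<forall>j k. f j = S \<longrightarrow> f k = S \<longrightarrow>
           column j Q \<bullet> (matrix_block S S D *v column k Q) = (if j = k then 1 else 0)) \<and>
        span {column j Q |j. f j = S} = local_complement D c P S)"

definition weak_approximation ::
    "real^'n^'n \<Rightarrow> real^'n^'n \<Rightarrow> real^'c^'n \<Rightarrow> real \<Rightarrow> bool" where
  "weak_approximation A D P \<eta> \<longleftrightarrow>
     (\<forall>v. \<exists>vc. energy_norm D (v - P *v vc) \<le> \<eta> * energy_norm A v)"


subsection \<open>The smoothed-aggregation polynomial\<close>

fun chebyshev_T :: "nat \<Rightarrow> real poly" where
  "chebyshev_T 0 = 1"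
| "chebyshev_T (Suc 0) = [:0, 1:]"
| "chebyshev_T (Suc (Suc k)) = [:0, 2:] * chebyshev_T (Suc k) - chebyshev_T k"

text \<open>
  The formula determines the polynomial from its values at \<open>t > 0\<close>; at \<open>t = 0\<close> it is not usable
  because of division by zero.
\<close>

definition sa_poly :: "nat \<Rightarrow> real poly" where
  "sa_poly \<nu> = (THE p. \<forall>t>0. poly p t =
     (-1) ^ \<nu> / real (2 * \<nu> + 1) * (poly (chebyshev_T (2 * \<nu> + 1)) (sqrt t) / sqrt t))"

text \<open>This is \<open>q\<^bsub>\<nu>-1\<^esub>\<close>, of degree \<open>\<nu> - 1\<close>.\<close>

definition sa_quotient :: "nat \<Rightarrow> real poly" where
  "sa_quotient \<nu> = (THE q. sa_poly \<nu> = 1 - [:0, 1:] * q)"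

lemma chebyshev_T_add4:
  "chebyshev_T (Suc (Suc (Suc (Suc k)))) = [:-2, 0, 4:] * chebyshev_T (Suc (Suc k)) - chebyshev_T k"
proof -
  define x :: "real poly" where "x = [:0, 2:]"
  define a where "a = chebyshev_T (Suc k)"
  define b where "b = chebyshev_T k"
  have "[:-2, 0, 4:] = x * x - 2"
    by (simp add: x_def numeral_poly)
  then have "x * (x * (x * a - b) - a) - (x * a - b) = [:-2, 0, 4:] * (x * a - b) - b"
    by (simp only:) (simp add: algebra_simps)
  then show ?thesis
    unfolding chebyshev_T.simps x_def a_def b_def .
qed

lemma chebyshev_T_odd:
  "\<exists>r. (\<forall>x. poly (chebyshev_T (2 * k + 1)) x = x * poly r (x ^ 2)) \<and>
       degree r = k \<and> coeff r k = 4 ^ k \<and> poly r 0 = (-1) ^ k * (2 * real k + 1)"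
proof (induction k rule: less_induct)
  case (less k)
  consider "k = 0" | "k = 1" | j where "k = Suc (Suc j)"
    by (metis One_nat_def not0_implies_Suc)
  then show ?case
  proof cases
    case 1
    then show ?thesis by (intro exI[of _ 1]) auto
  next
    case 2
    then show ?thesis
      by (intro exI[of _ "[:-3, 4:]"]) (auto simp: numeral_3_eq_3 algebra_simps power2_eq_square)
  next
    case 3
    obtain r where r: "\<And>x. poly (chebyshev_T (2 * j + 1)) x = x * poly r (x ^ 2)"
      "degree r = j" "poly r 0 = (-1) ^ j * (2 * real j + 1)"
      using less[of j] 3 by auto
    obtain s where s: "\<And>x. poly (chebyshev_T (2 * Suc j + 1)) x = x * poly s (x ^ 2)"
      "degree s = Suc j" "coeff s (Suc j) = 4 ^ Suc j"
      "poly s 0 = (-1) ^ Suc j * (2 * real (Suc j) + 1)"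
      using less[of "Suc j"] 3 by auto
    define u where "u = [:-2, 4:] * s - r"
    have val: "poly (chebyshev_T (2 * k + 1)) x = x * poly u (x ^ 2)" for x
    proof -
      have "chebyshev_T (2 * k + 1) =
          [:-2, 0, 4:] * chebyshev_T (2 * Suc j + 1) - chebyshev_T (2 * j + 1)"
        using chebyshev_T_add4[of "2 * j + 1"] 3 by (simp del: chebyshev_T.simps)
      then have "poly (chebyshev_T (2 * k + 1)) x =
          poly [:-2, 0, 4:] x * (x * poly s (x ^ 2)) - x * poly r (x ^ 2)"
        by (simp only: poly_diff poly_mult r s)
      then show ?thesis
        by (simp add: u_def algebra_simps power2_eq_square)
    qed
    have c: "coeff u k = 4 ^ k"
      using r s 3 by (simp add: u_def coeff_pCons coeff_eq_0)
    have "degree u \<le> k"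
      using r s 3 unfolding u_def
      by (intro degree_diff_le order.trans[OF degree_mult_le]) auto
    moreover have "k \<le> degree u"
      using c by (intro le_degree) auto
    ultimately have "degree u = k" by simp
    moreover have "poly u 0 = (-1) ^ k * (2 * real k + 1)"
      using r s 3 by (simp add: u_def algebra_simps)
    ultimately show ?thesis using val c by blast
  qed
qed

lemma real_poly_eqI_pos:
  fixes p q :: "real poly"
  assumes "\<forall>t>0. poly p t = poly q t"
  shows "p = q"
proof (rule ccontr)
  assume "p \<noteq> q"
  then have "finite {t. poly (p - q) t = 0}"
    by (intro poly_roots_finite) simp
  moreover have "{0<..} \<subseteq> {t. poly (p - q) t = 0}"
    using assms by auto
  ultimately show False
    using infinite_Ioi finite_subset by blast
qed

lemma sa_poly_props:
  shows sa_poly_pos: "\<And>t. t > 0 \<Longrightarrow> poly (sa_poly \<nu>) t =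
      (-1) ^ \<nu> / real (2 * \<nu> + 1) * (poly (chebyshev_T (2 * \<nu> + 1)) (sqrt t) / sqrt t)"
    and sa_poly_0: "poly (sa_poly \<nu>) 0 = 1"
    and degree_sa_poly: "degree (sa_poly \<nu>) = \<nu>"
proof -
  let ?P = "\<lambda>p. \<forall>t>0. poly p t =
     (-1) ^ \<nu> / real (2 * \<nu> + 1) * (poly (chebyshev_T (2 * \<nu> + 1)) (sqrt t) / sqrt t)"
  obtain r where r: "\<And>x. poly (chebyshev_T (2 * \<nu> + 1)) x = x * poly r (x ^ 2)"
    "degree r = \<nu>" "poly r 0 = (-1) ^ \<nu> * (2 * real \<nu> + 1)"
    using chebyshev_T_odd[of \<nu>] by blast
  define p where "p = smult ((-1) ^ \<nu> / real (2 * \<nu> + 1)) r"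
  have P: "?P p"
    unfolding r by (simp add: p_def)
  moreover have "p' = p" if "?P p'" for p'
    using that P by (intro real_poly_eqI_pos) simp
  ultimately have eq: "sa_poly \<nu> = p"
    unfolding sa_poly_def by (rule the_equality)
  show "poly (sa_poly \<nu>) t = (-1) ^ \<nu> / real (2 * \<nu> + 1) *
      (poly (chebyshev_T (2 * \<nu> + 1)) (sqrt t) / sqrt t)" if "t > 0" for t
    using P that eq by blast
  have "real (2 * \<nu> + 1) \<noteq> 0" by linarith
  then show "poly (sa_poly \<nu>) 0 = 1"
    unfolding eq p_def poly_smult r(3)
    by (simp add: field_simps flip: power_add mult_2)
  show "degree (sa_poly \<nu>) = \<nu>"
    using r by (simp add: eq p_def)
qed

lemma sa_quotient_props:
  shows sa_poly_eq: "sa_poly \<nu> = 1 - [:0, 1:] * sa_quotient \<nu>"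
    and degree_sa_quotient: "degree (sa_quotient \<nu>) = \<nu> - 1"
proof -
  have "poly (1 - sa_poly \<nu>) 0 = 0"
    by (simp add: sa_poly_0)
  then have "[:0, 1:] dvd 1 - sa_poly \<nu>"
    by (simp only: poly_eq_0_iff_dvd minus_zero)
  then obtain q where "1 - sa_poly \<nu> = [:0, 1:] * q"
    by (rule dvdE)
  then have q: "sa_poly \<nu> = 1 - [:0, 1:] * q"
    by (simp add: algebra_simps)
  moreover have "q' = q" if "sa_poly \<nu> = 1 - [:0, 1:] * q'" for q'
    using that q by simp
  ultimately have eq: "sa_quotient \<nu> = q"
    unfolding sa_quotient_def by (rule the_equality)
  then show 1: "sa_poly \<nu> = 1 - [:0, 1:] * sa_quotient \<nu>"
    using q by simp
  show "degree (sa_quotient \<nu>) = \<nu> - 1"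
  proof (cases "q = 0")
    case True
    then show ?thesis using eq q degree_sa_poly[of \<nu>] by simp
  next
    case False
    then have "degree ([:0, 1:] * q) = Suc (degree q)"
      by (simp add: degree_mult_eq)
    moreover have "degree (1 - [:0, 1:] * q) = degree ([:0, 1:] * q)"
      using calculation by (metis degree_minus degree_1 degree_add_eq_right
        uminus_add_conv_diff add.commute zero_less_Suc)
    ultimately show ?thesis
      using degree_sa_poly[of \<nu>] eq q by simp
  qed
qed


subsection \<open>The smoothed prolongation\<close>

definition fine_operator :: "real^'n^'n \<Rightarrow> real^'f^'n \<Rightarrow> real^'f^'f" where
  "fine_operator A Q = transpose Q ** A ** Q"

definition sa_approx_projection :: "nat \<Rightarrow> real^'n^'n \<Rightarrow> real^'f^'n \<Rightarrow> real^'n^'n" where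
  "sa_approx_projection \<nu> A Q =
     Q ** matrix_poly (sa_quotient \<nu>) (fine_operator A Q) ** transpose Q ** A"

definition smoothed_prolongation ::
    "nat \<Rightarrow> real^'n^'n \<Rightarrow> real^'f^'n \<Rightarrow> real^'c^'n \<Rightarrow> real^'c^'n" where
  "smoothed_prolongation \<nu> A Q P = (mat 1 - sa_approx_projection \<nu> A Q) ** P"

end

theory Submission
  imports Defs
begin

text \<open>
  Write \<open>Q\<close> for \<open>P\<^sub>\<bottom>\<close>, \<open>B = Q\<^sup>T A Q\<close> for the fine operator, \<open>p\<close> for the smoothed-aggregation
  polynomial and \<open>q\<close> for its quotient, so that \<open>q(B) B = I - p(B)\<close>. The Galerkin solution gives the
  smallest energy error over the range of the smoothed prolongation, so it suffices to exhibit one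
  good coarse vector for each \<open>u\<close>.

  Because \<open>P\<close> and \<open>Q\<close> have \<open>D\<close>-orthogonal ranges of complementary dimension, \<open>u = P x + Q y\<close>, and the
  vector to use is \<open>x\<close>. Let \<open>z\<close> solve \<open>B z = Q\<^sup>T A u\<close>, so that \<open>Q z\<close> is the \<open>A\<close>-orthogonal projection of
  \<open>u\<close> onto the range of \<open>Q\<close>. Then the error of the smoothed prolongation at \<open>x\<close> is
  \<open>Q z - Q p(B) (z - y)\<close> (lemma \<open>smoothed_prolongation_error\<close>): the part \<open>Q z\<close> would remain if \<open>B\<close>
  were inverted exactly, and the other part is the price of using \<open>q(B)\<close> instead.

  Weak approximation says that the fine part of any vector \<open>P x + Q y\<close> is controlled by its energy:
  \<open>norm y \<le> \<eta> * energy_norm A (P x + Q y)\<close> (lemma \<open>norm_fine_part_le\<close>). It is used twice. For the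
  vector \<open>Q z\<close> it makes the energy of \<open>Q z\<close> at most \<open>\<eta>\<close> times \<open>\<parallel>D\<^sup>-\<^sup>1\<parallel>\<^sup>1\<^sup>/\<^sup>2 \<parallel>A u\<parallel>\<close>. For
  \<open>u - Q z = P x + Q (y - z)\<close>, whose energy is at most that of \<open>u\<close>, it bounds \<open>norm (z - y)\<close> by \<open>\<eta>\<close>
  times the energy norm of \<open>u\<close>. The factor \<open>1 / (2 \<nu> + 1)\<close> comes from
  \<open>(2 \<nu> + 1)\<^sup>2 t p(t)\<^sup>2 \<le> 1\<close> on \<open>[0, 1]\<close>, which applies to \<open>B\<close> because \<open>0 \<le> B \<le> I\<close>. Instead of
  diagonalising \<open>B\<close>, the proof uses an algebraic certificate for this inequality, the Pell equation
  \<open>T\<^sup>2 + (1 - x\<^sup>2) U\<^sup>2 = 1\<close> between the Chebyshev polynomials of both kinds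
  (lemmas \<open>sa_poly_Pell\<close> and \<open>energy_norm_sa_poly_le\<close>).
  Finally \<open>\<eta> \<ge> 1\<close>, so a factor \<open>\<eta>\<close> may be replaced by \<open>\<eta>\<^sup>2\<close>.
\<close>

section \<open>Energy norms\<close>

lemma spd_inner: "spd B \<Longrightarrow> x \<bullet> (B *v y) = (B *v x) \<bullet> y"
  by (metis spd_def dot_lmul_matrix transpose_matrix_vector)

lemma spd_inner_swap: "spd B \<Longrightarrow> x \<bullet> (B *v y) = y \<bullet> (B *v x)"
  by (subst inner_commute) (simp only: spd_inner)

lemma inner_matrix_vector: "x \<bullet> (M *v y) = (transpose M *v x) \<bullet> y"
  for M :: "real^'a^'b"
  by (simp add: dot_lmul_matrix)

lemma spd_nonneg: "spd B \<Longrightarrow> 0 \<le> v \<bullet> (B *v v)"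
  unfolding spd_def by (cases "v = 0") (auto intro: less_imp_le)

lemma energy_norm_nonneg [simp]: "spd B \<Longrightarrow> 0 \<le> energy_norm B v"
  by (simp add: energy_norm_def spd_nonneg)

lemma energy_norm_power2: "spd B \<Longrightarrow> (energy_norm B v)\<^sup>2 = v \<bullet> (B *v v)"
  by (simp add: energy_norm_def spd_nonneg)

lemma energy_norm_minus: "energy_norm B (- v) = energy_norm B v"
  by (simp add: energy_norm_def vec.neg)

lemma energy_Cauchy_Schwarz:
  assumes "spd B"
  shows "x \<bullet> (B *v y) \<le> energy_norm B x * energy_norm B y"
proof (cases "y = 0")
  case False
  define a where "a = x \<bullet> (B *v y)"
  define b where "b = y \<bullet> (B *v y)"
  have b: "b > 0"
    using False assms by (simp add: b_def spd_def)
  \<comment> \<open>This multiple of the component of \<open>x\<close> that is \<open>B\<close>-orthogonal to \<open>y\<close> avoids division by \<open>b\<close>.\<close>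
  have "0 \<le> (b *\<^sub>R x - a *\<^sub>R y) \<bullet> (B *v (b *\<^sub>R x - a *\<^sub>R y))"
    by (rule spd_nonneg[OF assms])
  also have "\<dots> = b * (b * (x \<bullet> (B *v x)) - a\<^sup>2)"
    using spd_inner[OF assms, of x y]
    by (simp add: a_def b_def matrix_vector_mult_diff_distrib matrix_vector_mult_scaleR
        inner_diff inner_commute algebra_simps power2_eq_square)
  finally have "a\<^sup>2 \<le> (x \<bullet> (B *v x)) * b"
    using b by (simp add: zero_le_mult_iff mult.commute)
  then have "sqrt (a\<^sup>2) \<le> sqrt ((x \<bullet> (B *v x)) * b)"
    by (rule real_sqrt_le_mono)
  then show ?thesis
    by (simp add: energy_norm_def real_sqrt_mult a_def b_def)
qed (simp add: energy_norm_def)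

lemma energy_norm_le_of_orthogonal:
  assumes "spd B" and "x \<bullet> (B *v y) = 0"
  shows "energy_norm B x \<le> energy_norm B (x + y)"
  unfolding energy_norm_def
  using assms(2) spd_inner[OF assms(1), of x y] spd_nonneg[OF assms(1), of y]
  by (intro real_sqrt_le_mono) (simp add: matrix_vector_right_distrib inner_add inner_commute)

lemma energy_norm_triangle:
  assumes "spd B"
  shows "energy_norm B (x + y) \<le> energy_norm B x + energy_norm B y"
proof (rule power2_le_imp_le)
  have "(energy_norm B (x + y))\<^sup>2 = x \<bullet> (B *v x) + 2 * (x \<bullet> (B *v y)) + y \<bullet> (B *v y)"
    using spd_inner[OF assms, of x y]
    by (simp add: energy_norm_power2[OF assms] matrix_vector_right_distrib inner_add inner_commute)
  also have "\<dots> \<le> (energy_norm B x + energy_norm B y)\<^sup>2"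
    using energy_Cauchy_Schwarz[OF assms, of x y]
    by (simp add: power2_sum energy_norm_power2[OF assms])
  finally show "(energy_norm B (x + y))\<^sup>2 \<le> (energy_norm B x + energy_norm B y)\<^sup>2" .
qed (simp add: assms)

lemma spd_mult_eq_0: "spd B \<Longrightarrow> B *v x = 0 \<Longrightarrow> x = 0"
  by (metis spd_def inner_zero_right less_irrefl)

lemma spd_invertible: "spd B \<Longrightarrow> invertible B"
  by (simp add: invertible_left_inverse matrix_left_invertible_ker spd_mult_eq_0)

lemma
  fixes B :: "real^'n^'n"
  assumes "invertible B"
  shows matrix_inv_right: "B ** matrix_inv B = mat 1"
    and matrix_inv_left: "matrix_inv B ** B = mat 1"
  using someI_ex[OF assms[unfolded invertible_def]] by (simp_all add: matrix_inv_def)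

lemma spd_ex1_solution:
  assumes "spd B"
  shows "\<exists>!x. B *v x = b"
proof (rule ex1I)
  show "B *v (matrix_inv B *v b) = b"
    by (simp add: matrix_vector_mul_assoc matrix_inv_right[OF spd_invertible[OF assms]])
  fix y assume "B *v y = b"
  then show "y = matrix_inv B *v b"
    using matrix_inv_left[OF spd_invertible[OF assms]]
    by (auto simp: matrix_vector_mul_assoc)
qed

lemma fine_operator_inner:
  fixes Q :: "real^'f^'n"
  shows "x \<bullet> (fine_operator A Q *v y) = (Q *v x) \<bullet> (A *v (Q *v y))"
  by (simp only: fine_operator_def matrix_vector_mul_assoc[symmetric]
      inner_matrix_vector[of x "transpose Q"] transpose_transpose)

lemma energy_norm_fine_operator: "energy_norm (fine_operator A Q) x = energy_norm A (Q *v x)"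
  by (simp add: energy_norm_def fine_operator_inner)

lemma spd_fine_operator:
  assumes "spd A" "\<And>x. Q *v x = 0 \<Longrightarrow> x = 0"
  shows "spd (fine_operator A Q)"
  using assms
  by (auto simp: spd_def fine_operator_inner)
     (simp add: fine_operator_def matrix_transpose_mul matrix_mul_assoc)


section \<open>Spectral norms\<close>

lemma norm_le_spectral: "norm (B *v v) \<le> spectral_norm B * norm v"
  unfolding spectral_norm_def by (rule onorm) (rule matrix_vector_mul_bounded_linear)

lemma spectral_norm_nonneg [simp]: "0 \<le> spectral_norm B"
  unfolding spectral_norm_def by (rule onorm_pos_le) (rule matrix_vector_mul_bounded_linear)

text \<open>
  With \<open>w = A v\<close>, the Cauchy-Schwarz inequality of the energy product bounds \<open>w \<bullet> w = v \<bullet> A w\<close> by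
  the quadratic forms at \<open>v\<close> and \<open>w\<close>, hence by \<open>C * norm v * norm w\<close>. This is the fact that the
  spectral norm of a symmetric positive definite matrix is its largest Rayleigh quotient, obtained
  without eigenvectors.
\<close>

lemma spectral_norm_le_of_quadratic_form:
  assumes "spd A" and "\<And>v. v \<bullet> (A *v v) \<le> C * (norm v)\<^sup>2"
  shows "spectral_norm A \<le> C"
  unfolding spectral_norm_def
proof (rule onorm_le)
  fix v
  let ?w = "A *v v"
  have "(norm ?w)\<^sup>2 = v \<bullet> (A *v ?w)"
    by (simp add: spd_inner[OF assms(1), of v] power2_norm_eq_inner)
  also have "\<dots> \<le> energy_norm A v * energy_norm A ?w"
    by (rule energy_Cauchy_Schwarz[OF assms(1)])
  also have "\<dots> \<le> sqrt (C * (norm v)\<^sup>2) * sqrt (C * (norm ?w)\<^sup>2)"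
    unfolding energy_norm_def
    by (intro mult_mono real_sqrt_le_mono assms(2)) (simp_all add: spd_nonneg[OF assms(1)]
        order_trans[OF spd_nonneg[OF assms(1)] assms(2)])
  also have "\<dots> = \<bar>C\<bar> * norm v * norm ?w"
    by (simp add: real_sqrt_mult)
  finally have "norm ?w \<le> \<bar>C\<bar> * norm v"
    by (cases "?w = 0") (simp_all add: power2_eq_square)
  moreover have "0 \<le> C"
    using order_trans[OF spd_nonneg[OF assms(1)] assms(2), of "1"]
    by (simp add: zero_le_mult_iff)
  ultimately show "norm ?w \<le> C * norm v"
    by simp
qed

lemma quadratic_form_le_spectral:
  assumes "spd D"
  shows "v \<bullet> (D *v v) \<le> spectral_norm D * (norm v)\<^sup>2"
proof -
  have "v \<bullet> (D *v v) \<le> norm v * norm (D *v v)"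
    by (rule norm_cauchy_schwarz)
  also have "\<dots> \<le> norm v * (spectral_norm D * norm v)"
    by (intro mult_left_mono norm_le_spectral) simp
  finally show ?thesis
    by (simp add: power2_eq_square mult_ac)
qed

text \<open>
  The energy Cauchy-Schwarz inequality for \<open>v \<bullet> v = v \<bullet> D (D\<^sup>-\<^sup>1 v)\<close>.
\<close>

lemma norm_le_energy_norm:
  assumes "spd D"
  shows "norm v \<le> sqrt (spectral_norm (matrix_inv D)) * energy_norm D v"
proof -
  let ?w = "matrix_inv D *v v"
  have w: "D *v ?w = v"
    by (simp add: matrix_vector_mul_assoc matrix_inv_right[OF spd_invertible[OF assms]])
  have "energy_norm D ?w \<le> sqrt (spectral_norm (matrix_inv D) * (norm v)\<^sup>2)"
    unfolding energy_norm_def w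
  proof (rule real_sqrt_le_mono)
    have "?w \<bullet> v \<le> norm ?w * norm v"
      by (rule norm_cauchy_schwarz)
    also have "\<dots> \<le> (spectral_norm (matrix_inv D) * norm v) * norm v"
      by (intro mult_right_mono norm_le_spectral) simp
    finally show "?w \<bullet> v \<le> spectral_norm (matrix_inv D) * (norm v)\<^sup>2"
      by (simp add: power2_eq_square mult_ac)
  qed
  then have *: "energy_norm D ?w \<le> sqrt (spectral_norm (matrix_inv D)) * norm v"
    by (simp add: real_sqrt_mult)
  have "(norm v)\<^sup>2 = v \<bullet> (D *v ?w)"
    by (simp add: w power2_norm_eq_inner)
  also have "\<dots> \<le> energy_norm D v * energy_norm D ?w"
    by (rule energy_Cauchy_Schwarz[OF assms])
  also have "\<dots> \<le> energy_norm D v * (sqrt (spectral_norm (matrix_inv D)) * norm v)"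
    by (intro mult_left_mono * energy_norm_nonneg assms)
  finally show ?thesis
    by (cases "v = 0") (simp_all add: power2_eq_square mult_ac assms)
qed


section \<open>Polynomials of a matrix\<close>

text \<open>
  Extending the summation beyond the degree makes sums of polynomials of different degrees
  comparable.
\<close>

lemma matrix_poly_altdef:
  assumes "degree q \<le> n"
  shows "matrix_poly q B = (\<Sum>k\<le>n. coeff q k *\<^sub>R matrix_power B k)"
  unfolding matrix_poly_def
  by (rule sum.mono_neutral_left) (use assms in \<open>auto simp: coeff_eq_0\<close>)

lemma matrix_poly_0 [simp]: "matrix_poly 0 B = 0"
  by (simp add: matrix_poly_def)

lemma matrix_poly_add: "matrix_poly (p + q) B = matrix_poly p B + matrix_poly q B"
proof -
  have "degree (p + q) \<le> max (degree p) (degree q)"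
    by (rule degree_add_le_max)
  then show ?thesis
    by (simp add: matrix_poly_altdef[of _ "max (degree p) (degree q)"] scaleR_add_left sum.distrib)
qed

lemma matrix_poly_smult: "matrix_poly (smult a p) B = a *\<^sub>R matrix_poly p B"
  by (simp add: matrix_poly_altdef[of _ "degree p"] scaleR_right.sum degree_smult_le)

lemma matrix_poly_pCons: "matrix_poly (pCons a p) B = a *\<^sub>R mat 1 + B ** matrix_poly p B"
proof -
  have "B ** matrix_poly p B = (\<Sum>k\<le>degree p. coeff p k *\<^sub>R (B ** matrix_power B k))"
    unfolding matrix_poly_def
    by (induction rule: infinite_finite_induct)
       (simp_all add: matrix_add_ldistrib matrix_scalar_ac scalar_matrix_assoc)
  moreover have "matrix_poly (pCons a p) B
      = (\<Sum>k\<le>Suc (degree p). coeff (pCons a p) k *\<^sub>R matrix_power B k)"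
    by (rule matrix_poly_altdef[OF degree_pCons_le])
  ultimately show ?thesis
    by (simp add: sum.atMost_Suc_shift del: sum.atMost_Suc)
qed

lemma matrix_poly_1 [simp]: "matrix_poly 1 B = mat 1"
  by (simp add: one_pCons matrix_poly_pCons)

lemma matrix_poly_mult:
  fixes B :: "real^'n^'n"
  shows "matrix_poly (p * q) B = matrix_poly p B ** matrix_poly q B"
proof (induction p)
  case (pCons a p)
  have "(X + Y) ** Z = X ** Z + Y ** Z" for X Y Z :: "real^'n^'n"
    by (simp add: matrix_matrix_mult_def vec_eq_iff sum.distrib distrib_right)
  with pCons show ?case
    by (simp add: mult_pCons_left matrix_poly_add matrix_poly_smult matrix_poly_pCons
        matrix_mul_assoc scalar_matrix_assoc[symmetric])
qed simp

lemma matrix_poly_commute: "matrix_poly p B ** B = B ** matrix_poly p B"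
proof -
  have "matrix_poly [:0, 1:] B = B"
    by (simp add: matrix_poly_pCons)
  then show ?thesis
    by (metis matrix_poly_mult mult.commute)
qed

lemma transpose_matrix_poly:
  fixes B :: "real^'n^'n"
  assumes "transpose B = B"
  shows "transpose (matrix_poly p B) = matrix_poly p B"
proof (induction p)
  case 0
  show ?case by (simp add: transpose_def zero_vec_def)
next
  case (pCons a p)
  have "transpose (X + Y) = transpose X + transpose Y" for X Y :: "real^'n^'n"
    by (simp add: transpose_def vec_eq_iff)
  with pCons show ?case
    by (simp add: matrix_poly_pCons matrix_transpose_mul transpose_scalar assms matrix_poly_commute)
qed


section \<open>Damping by the smoothed-aggregation polynomial\<close>

text \<open>
  The polynomial \<open>r\<close> is the Chebyshev polynomial of the second kind of degree \<open>2 * k\<close>, which is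
  even, written as a polynomial in \<open>x\<^sup>2\<close>. The first equation is
  \<open>cos ((m + 1) \<theta>) = cos \<theta> cos (m \<theta>) - sin\<^sup>2 \<theta> (sin (m \<theta>) / sin \<theta>)\<close> for \<open>x = cos \<theta>\<close> and
  \<open>m = 2 * k + 1\<close>; it carries the induction. The second one is \<open>cos\<^sup>2 + sin\<^sup>2 = 1\<close> at \<open>m \<theta>\<close>.
\<close>

lemma chebyshev_T_odd_Pell:
  "\<exists>r. \<forall>x. poly (chebyshev_T (2 * k + 2)) x
             = x * poly (chebyshev_T (2 * k + 1)) x - (1 - x\<^sup>2) * poly r (x\<^sup>2) \<and>
           (poly (chebyshev_T (2 * k + 1)) x)\<^sup>2 + (1 - x\<^sup>2) * (poly r (x\<^sup>2))\<^sup>2 = 1"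
proof (induction k)
  case 0
  show ?case
    by (intro exI[of _ 1]) (simp add: numeral_2_eq_2 algebra_simps power2_eq_square)
next
  case (Suc k)
  obtain r where r:
      "\<And>x. poly (chebyshev_T (2 * k + 2)) x
             = x * poly (chebyshev_T (2 * k + 1)) x - (1 - x\<^sup>2) * poly r (x\<^sup>2)"
      "\<And>x. (poly (chebyshev_T (2 * k + 1)) x)\<^sup>2 + (1 - x\<^sup>2) * (poly r (x\<^sup>2))\<^sup>2 = 1"
    using Suc by blast
  obtain s where s: "\<And>x. poly (chebyshev_T (2 * k + 1)) x = x * poly s (x\<^sup>2)"
    using chebyshev_T_odd[of k] by blast
  show ?case
    \<comment> \<open>The addition theorem for \<open>sin (m \<theta> + 2 \<theta>) / sin \<theta>\<close>, with \<open>cos (2 \<theta>) = 2 x\<^sup>2 - 1\<close> and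
        \<open>sin (2 \<theta>) / sin \<theta> = 2 x\<close>; the polynomials are in the variable \<open>x\<^sup>2\<close>.\<close>
  proof (intro exI[of _ "[:-1, 2:] * r + [:0, 2:] * s"] allI)
    fix x :: real
    let ?T = "\<lambda>m. poly (chebyshev_T m) x"
    let ?r = "poly r (x\<^sup>2)" and ?s = "poly s (x\<^sup>2)"
    have T2: "?T (2 * k + 2) = x * (x * ?s) - (1 - x\<^sup>2) * ?r"
      unfolding r(1) s ..
    have T3: "?T (2 * Suc k + 1) = 2 * x * ?T (2 * k + 2) - ?T (2 * k + 1)"
      using chebyshev_T.simps(3)[of "2 * k + 1"] by (simp del: chebyshev_T.simps)
    have T4: "?T (2 * Suc k + 2) = 2 * x * ?T (2 * Suc k + 1) - ?T (2 * k + 2)"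
      using chebyshev_T.simps(3)[of "2 * k + 2"] by (simp del: chebyshev_T.simps)
    have u: "poly ([:-1, 2:] * r + [:0, 2:] * s) (x\<^sup>2) = (2 * x\<^sup>2 - 1) * ?r + 2 * x\<^sup>2 * ?s"
      by (simp add: algebra_simps)
    have P: "(x * ?s)\<^sup>2 + (1 - x\<^sup>2) * ?r\<^sup>2 = 1"
      using r(2)[of x] unfolding s .
    show "?T (2 * Suc k + 2) = x * ?T (2 * Suc k + 1)
            - (1 - x\<^sup>2) * poly ([:-1, 2:] * r + [:0, 2:] * s) (x\<^sup>2) \<and>
          (?T (2 * Suc k + 1))\<^sup>2
            + (1 - x\<^sup>2) * (poly ([:-1, 2:] * r + [:0, 2:] * s) (x\<^sup>2))\<^sup>2 = 1"
    proof
      show "?T (2 * Suc k + 2) = x * ?T (2 * Suc k + 1)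
              - (1 - x\<^sup>2) * poly ([:-1, 2:] * r + [:0, 2:] * s) (x\<^sup>2)"
        unfolding u T4 T3 T2 s by (simp add: algebra_simps power2_eq_square)
      have "(?T (2 * Suc k + 1))\<^sup>2
              + (1 - x\<^sup>2) * (poly ([:-1, 2:] * r + [:0, 2:] * s) (x\<^sup>2))\<^sup>2
          = (x * ?s)\<^sup>2 + (1 - x\<^sup>2) * ?r\<^sup>2"
        unfolding u T3 T2 s by (simp add: algebra_simps power2_eq_square)
      then show "(?T (2 * Suc k + 1))\<^sup>2
              + (1 - x\<^sup>2) * (poly ([:-1, 2:] * r + [:0, 2:] * s) (x\<^sup>2))\<^sup>2 = 1"
        unfolding P .
    qed
  qed
qed

text \<open>
  In the variable \<open>t = x\<^sup>2\<close> the Pell equation reads \<open>(2 \<nu> + 1)\<^sup>2 t p(t)\<^sup>2 + (1 - t) r(t)\<^sup>2 = 1\<close>. The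
  factors are arranged as \<open>g * (h * g)\<close>, so that a symmetric outer factor can be moved to the other
  side of an inner product once a matrix is substituted for \<open>t\<close>.
\<close>

lemma sa_poly_Pell:
  "\<exists>r. sa_poly \<nu> * smult ((real (2 * \<nu> + 1))\<^sup>2) ([:0, 1:] * sa_poly \<nu>) + r * ([:1, -1:] * r) = 1"
proof -
  obtain r where r:
    "\<And>x. (poly (chebyshev_T (2 * \<nu> + 1)) x)\<^sup>2 + (1 - x\<^sup>2) * (poly r (x\<^sup>2))\<^sup>2 = 1"
    using chebyshev_T_odd_Pell[of \<nu>] by blast
  have "poly (sa_poly \<nu> * smult ((real (2 * \<nu> + 1))\<^sup>2) ([:0, 1:] * sa_poly \<nu>)
          + r * ([:1, -1:] * r)) t = poly 1 t" if t: "t > 0" for t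
  proof -
    let ?T = "poly (chebyshev_T (2 * \<nu> + 1)) (sqrt t)"
    have "real (2 * \<nu> + 1) \<noteq> 0"
      by linarith
    then have "(real (2 * \<nu> + 1))\<^sup>2 * (t * (poly (sa_poly \<nu>) t)\<^sup>2) = ?T\<^sup>2"
      unfolding sa_poly_pos[OF t] using t
      by (simp add: power_mult_distrib power_divide del: of_nat_add of_nat_mult flip: power_mult)
    then show ?thesis
      using r[of "sqrt t"] t by (simp add: power2_eq_square algebra_simps)
  qed
  then show ?thesis
    by (intro exI[of _ r] real_poly_eqI_pos) blast
qed

text \<open>
  Substituting \<open>B\<close> into the Pell equation gives
  \<open>w \<bullet> w = (2 \<nu> + 1)\<^sup>2 (y \<bullet> B y) + z \<bullet> (I - B) z\<close> with \<open>y = p(B) w\<close> and \<open>z = r(B) w\<close>, and the last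
  term is nonnegative.
\<close>

lemma energy_norm_sa_poly_le:
  assumes "spd B" and "\<And>v. v \<bullet> (B *v v) \<le> (norm v)\<^sup>2"
  shows "energy_norm B (matrix_poly (sa_poly \<nu>) B *v w) \<le> norm w / real (2 * \<nu> + 1)"
proof -
  have sym: "x \<bullet> (matrix_poly p B *v y) = (matrix_poly p B *v x) \<bullet> y" for p x y
    using assms(1) by (metis inner_matrix_vector spd_def transpose_matrix_poly)
  obtain r where r: "sa_poly \<nu> * smult ((real (2 * \<nu> + 1))\<^sup>2) ([:0, 1:] * sa_poly \<nu>)
      + r * ([:1, -1:] * r) = 1"
    using sa_poly_Pell by blast
  have "B ** (- mat 1) = - B"
    using matrix_scalar_ac[of B "- 1" "mat 1"] by simp
  then have lin: "matrix_poly [:0, 1:] B = B" "matrix_poly [:1, -1:] B = mat 1 - B"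
    by (simp_all add: matrix_poly_pCons)
  let ?y = "matrix_poly (sa_poly \<nu>) B *v w" and ?z = "matrix_poly r B *v w"
  have "w \<bullet> w = w \<bullet> (matrix_poly 1 B *v w)"
    by simp
  also have "\<dots> = (real (2 * \<nu> + 1))\<^sup>2 * (?y \<bullet> (B *v ?y)) + ?z \<bullet> (?z - B *v ?z)"
    by (simp only: r[symmetric] matrix_poly_add matrix_poly_mult matrix_poly_smult lin
        matrix_vector_mult_add_rdistrib matrix_vector_mul_assoc[symmetric] inner_add_right sym
        scaleR_matrix_vector_assoc[symmetric] matrix_vector_mult_diff_rdistrib
        matrix_vector_mul_lid inner_scaleR_right)
  also have "\<dots> \<ge> (real (2 * \<nu> + 1))\<^sup>2 * (?y \<bullet> (B *v ?y))"
    using assms(2)[of ?z] by (simp add: inner_diff_right power2_norm_eq_inner)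
  finally have "(real (2 * \<nu> + 1) * energy_norm B ?y)\<^sup>2 \<le> (norm w)\<^sup>2"
    by (simp add: power_mult_distrib energy_norm_power2[OF assms(1)] power2_norm_eq_inner)
  then have "real (2 * \<nu> + 1) * energy_norm B ?y \<le> norm w"
    by (rule power2_le_imp_le) simp
  moreover have "real (2 * \<nu> + 1) > 0"
    by linarith
  ultimately show ?thesis
    by (simp add: pos_le_divide_eq mult.commute)
qed


section \<open>Splittings into coarse and fine vectors\<close>

text \<open>
  This is what the aggregation-based construction provides: two coordinate maps with \<open>D\<close>-orthogonal
  ranges, of which the fine one is \<open>D\<close>-orthonormal. The aggregates themselves no longer appear.
\<close>

locale fine_coarse_splitting =
  fixes A D :: "real^'n^'n"
    and P :: "real^'c^'n"
    and Q :: "real^'f^'n"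
    and \<eta> :: real
  assumes spd_A: "spd A"
    and spd_D: "spd D"
    and A_le_D: "v \<bullet> (A *v v) \<le> v \<bullet> (D *v v)"
    and P_injective: "P *v x = 0 \<Longrightarrow> x = 0"
    and P_orthogonal_Q: "(P *v x) \<bullet> (D *v (Q *v y)) = 0"
    and Q_orthonormal: "(Q *v y) \<bullet> (D *v (Q *v y')) = y \<bullet> y'"
    and weak_approximation: "weak_approximation A D P \<eta>"
begin

lemma energy_norm_Q: "energy_norm D (Q *v y) = norm y"
  by (simp add: energy_norm_def Q_orthonormal norm_eq_sqrt_inner)

lemma Q_injective: "Q *v y = 0 \<Longrightarrow> y = 0"
  using energy_norm_Q[of y] by (simp add: energy_norm_def)

lemma PQ_injective:
  assumes "P *v x + Q *v y = 0"
  shows "x = 0 \<and> y = 0"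
proof -
  have "(P *v x + Q *v y) \<bullet> (D *v (Q *v y)) = y \<bullet> y"
    by (simp add: inner_add_left P_orthogonal_Q Q_orthonormal)
  then have "y = 0"
    using assms by simp
  moreover from this have "P *v x = 0"
    using assms by simp
  ultimately show ?thesis
    by (blast intro: P_injective)
qed

lemma exists_splitting:
  assumes "CARD('c) + CARD('f) = CARD('n)"
  shows "\<exists>x y. v = P *v x + Q *v y"
proof -
  define L where "L = (\<lambda>(x, y). P *v x + Q *v y)"
  have lin: "linear L"
    by (rule linearI) (auto simp: L_def matrix_vector_right_distrib matrix_vector_mult_scaleR
        scaleR_add_right)
  have "inj L"
    unfolding linear_injective_0[OF lin] using PQ_injective by (auto simp: L_def zero_prod_def)
  then have "dim (range L) = DIM((real^'c) \<times> (real^'f))"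
    by (subst dim_image_eq[OF lin]) (auto simp: inj_on_def)
  also have "\<dots> = DIM(real^'n)"
    using assms by simp
  finally have "range L = UNIV"
    using linear_subspace_image[OF lin subspace_UNIV] dim_eq_full span_eq_iff by metis
  then obtain w where "v = L w"
    by blast
  then show ?thesis
    by (cases w) (auto simp: L_def)
qed

lemma spd_fine: "spd (fine_operator A Q)"
  by (rule spd_fine_operator[OF spd_A Q_injective])

lemma fine_operator_le: "y \<bullet> (fine_operator A Q *v y) \<le> (norm y)\<^sup>2"
  using A_le_D[of "Q *v y"] by (simp add: fine_operator_inner Q_orthonormal power2_norm_eq_inner)

text \<open>
  For every coarse vector \<open>x'\<close> the \<open>D\<close>-distance of \<open>P x + Q y\<close> from \<open>P x'\<close> is at least
  \<open>norm y\<close>, since \<open>Q y\<close> is \<open>D\<close>-orthogonal to the range of \<open>P\<close>.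
\<close>

lemma norm_fine_part_le: "norm y \<le> \<eta> * energy_norm A (P *v x + Q *v y)"
proof -
  obtain x' where x': "energy_norm D (P *v x + Q *v y - P *v x')
      \<le> \<eta> * energy_norm A (P *v x + Q *v y)"
    using weak_approximation unfolding weak_approximation_def by blast
  have "norm y \<le> energy_norm D (Q *v y + P *v (x - x'))"
    unfolding energy_norm_Q[symmetric]
    by (rule energy_norm_le_of_orthogonal[OF spd_D])
       (simp only: spd_inner_swap[OF spd_D, of "Q *v y"] P_orthogonal_Q)
  also have "Q *v y + P *v (x - x') = P *v x + Q *v y - P *v x'"
    by (simp add: matrix_vector_mult_diff_distrib)
  finally show ?thesis
    using x' by simp
qed

text \<open>
  For a nonzero vector \<open>Q y\<close> the previous bound and \<open>A \<le> D\<close> give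
  \<open>norm y \<le> \<eta> * energy_norm A (Q y) \<le> \<eta> * norm y\<close>; here \<open>y\<close> is the all-ones vector.
\<close>

lemma eta_ge_1: "1 \<le> \<eta>"
proof -
  have e: "norm (1 :: real^'f) \<le> \<eta> * energy_norm A (Q *v 1)"
    using norm_fine_part_le[of 1 0] by simp
  moreover have n: "0 < norm (1 :: real^'f)"
    by simp
  ultimately have "0 < \<eta>"
    using energy_norm_nonneg[OF spd_A] by (smt (verit) zero_less_mult_iff)
  moreover have "energy_norm A (Q *v 1) \<le> norm (1 :: real^'f)"
    unfolding energy_norm_Q[symmetric] energy_norm_def by (rule real_sqrt_le_mono[OF A_le_D])
  ultimately have "norm (1 :: real^'f) \<le> \<eta> * norm (1 :: real^'f)"
    using e by (meson less_imp_le mult_left_mono order_trans)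
  then show ?thesis
    using n by simp
qed

lemma smoothed_prolongation_mult:
  "smoothed_prolongation \<nu> A Q P *v x
     = P *v x - Q *v (matrix_poly (sa_quotient \<nu>) (fine_operator A Q)
                        *v (transpose Q *v (A *v (P *v x))))"
  by (simp only: smoothed_prolongation_def sa_approx_projection_def
      matrix_vector_mul_assoc[symmetric] matrix_vector_mult_diff_rdistrib matrix_vector_mul_lid)

lemma smoothed_prolongation_injective:
  assumes "smoothed_prolongation \<nu> A Q P *v x = 0"
  shows "x = 0"
proof -
  have "P *v x + Q *v (- (matrix_poly (sa_quotient \<nu>) (fine_operator A Q)
                        *v (transpose Q *v (A *v (P *v x))))) = 0"
    using assms unfolding smoothed_prolongation_mult vec.neg by simp
  then show ?thesis
    using PQ_injective by blast
qed

text \<open>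
  Since \<open>P x = u - Q y\<close>, the smoothing step sees the residual \<open>Q\<^sup>T A P x = B (z - y)\<close>, and
  \<open>q(B) B (z - y) = (z - y) - p(B) (z - y)\<close>. Adding the term \<open>Q y\<close> that \<open>P x\<close> misses leaves
  \<open>Q z - Q p(B) (z - y)\<close>.
\<close>

lemma smoothed_prolongation_error:
  assumes u: "u = P *v x + Q *v y"
    and z: "fine_operator A Q *v z = transpose Q *v (A *v u)"
  shows "u - smoothed_prolongation \<nu> A Q P *v x
           = Q *v z - Q *v (matrix_poly (sa_poly \<nu>) (fine_operator A Q) *v (z - y))"
proof -
  let ?B = "fine_operator A Q"
  have B: "?B *v w = transpose Q *v (A *v (Q *v w))" for w
    by (simp only: fine_operator_def matrix_vector_mul_assoc[symmetric])
  have "transpose Q *v (A *v (P *v x)) = ?B *v (z - y)"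
    unfolding matrix_vector_mult_diff_distrib z unfolding B u matrix_vector_right_distrib by simp
  moreover have "matrix_poly (sa_quotient \<nu>) ?B *v (?B *v w) = w - matrix_poly (sa_poly \<nu>) ?B *v w"
    for w
  proof -
    have "[:0, 1:] * sa_quotient \<nu> + sa_poly \<nu> = 1"
      by (subst sa_poly_eq) simp
    then have "matrix_poly ([:0, 1:] * sa_quotient \<nu> + sa_poly \<nu>) ?B *v w = w"
      by simp
    moreover have "matrix_poly [:0, 1:] ?B = ?B"
      by (simp add: matrix_poly_pCons)
    ultimately have "(?B ** matrix_poly (sa_quotient \<nu>) ?B) *v w + matrix_poly (sa_poly \<nu>) ?B *v w = w"
      by (simp only: matrix_poly_add matrix_poly_mult matrix_vector_mult_add_rdistrib)
    then show ?thesis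
      by (simp add: matrix_vector_mul_assoc matrix_poly_commute eq_diff_eq)
  qed
  ultimately show ?thesis
    unfolding smoothed_prolongation_mult
    by (simp add: u matrix_vector_mult_diff_distrib)
qed

text \<open>
  The square of the left-hand side is \<open>(Q z) \<bullet> (A u)\<close>. Bounding the Euclidean norm of \<open>Q z\<close> by its
  \<open>D\<close>-norm, and that by its energy norm through weak approximation, leaves one factor of the energy
  norm on the right, which cancels.
\<close>

lemma energy_norm_fine_solution_le:
  assumes z: "fine_operator A Q *v z = transpose Q *v (A *v u)"
  shows "energy_norm A (Q *v z) \<le> \<eta> * sqrt (spectral_norm (matrix_inv D)) * norm (A *v u)"
proof -
  let ?s = "sqrt (spectral_norm (matrix_inv D))" and ?e = "energy_norm A (Q *v z)"
  have "norm (Q *v z) \<le> ?s * norm z"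
    using norm_le_energy_norm[OF spd_D, of "Q *v z"] by (simp only: energy_norm_Q)
  also have "\<dots> \<le> ?s * (\<eta> * ?e)"
    using norm_fine_part_le[of z 0] by (intro mult_left_mono) simp_all
  finally have Qz: "norm (Q *v z) \<le> ?s * (\<eta> * ?e)" .
  have "?e\<^sup>2 = z \<bullet> (fine_operator A Q *v z)"
    by (simp add: energy_norm_power2[OF spd_A] fine_operator_inner)
  also have "\<dots> = (Q *v z) \<bullet> (A *v u)"
    unfolding z inner_matrix_vector[of z "transpose Q"] transpose_transpose ..
  also have "\<dots> \<le> norm (Q *v z) * norm (A *v u)"
    by (rule norm_cauchy_schwarz)
  also have "\<dots> \<le> (?s * (\<eta> * ?e)) * norm (A *v u)"
    by (intro mult_right_mono Qz) simp
  finally have *: "?e * ?e \<le> (\<eta> * ?s * norm (A *v u)) * ?e"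
    by (simp add: power2_eq_square mult_ac)
  show ?thesis
  proof (cases "?e = 0")
    case True
    then show ?thesis
      using eta_ge_1 by simp
  next
    case False
    then have "?e > 0"
      using energy_norm_nonneg[OF spd_A, of "Q *v z"] by simp
    then show ?thesis
      using * by (rule mult_right_le_imp_le[rotated])
  qed
qed

text \<open>
  The vector \<open>z - y\<close> is, up to sign, the fine part of \<open>u - Q z\<close>. As \<open>Q z\<close> is the energy projection
  of \<open>u\<close>, subtracting it does not increase the energy.
\<close>

lemma norm_fine_residual_le:
  assumes u: "u = P *v x + Q *v y"
    and z: "fine_operator A Q *v z = transpose Q *v (A *v u)"
  shows "norm (z - y) \<le> \<eta> * energy_norm A u"
proof -
  have "norm (z - y) \<le> \<eta> * energy_norm A (P *v x + Q *v (y - z))"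
    using norm_fine_part_le[of "y - z" x] by (simp add: norm_minus_commute)
  also have "P *v x + Q *v (y - z) = u - Q *v z"
    by (simp add: u matrix_vector_mult_diff_distrib)
  also have "energy_norm A (u - Q *v z) \<le> energy_norm A (u - Q *v z + Q *v z)"
  proof (rule energy_norm_le_of_orthogonal[OF spd_A])
    have "(Q *v z) \<bullet> (A *v u) = z \<bullet> (fine_operator A Q *v z)"
      unfolding z inner_matrix_vector[of z "transpose Q"] transpose_transpose ..
    then have "(Q *v z) \<bullet> (A *v (u - Q *v z)) = 0"
      by (simp add: fine_operator_inner matrix_vector_mult_diff_distrib inner_diff_right)
    then show "(u - Q *v z) \<bullet> (A *v (Q *v z)) = 0"
      by (simp only: spd_inner_swap[OF spd_A, of _ "Q *v z"])
  qed
  finally show ?thesis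
    using eta_ge_1 by simp
qed

lemma smoothed_prolongation_approximation:
  assumes "CARD('c) + CARD('f) = CARD('n)"
  shows "\<exists>x. energy_norm A (u - smoothed_prolongation \<nu> A Q P *v x)
               \<le> \<eta> * sqrt (spectral_norm (matrix_inv D)) * norm (A *v u)
                  + \<eta> / real (2 * \<nu> + 1) * energy_norm A u"
proof -
  let ?B = "fine_operator A Q"
  obtain x y where u: "u = P *v x + Q *v y"
    using exists_splitting[OF assms] by blast
  obtain z where z: "?B *v z = transpose Q *v (A *v u)"
    using spd_ex1_solution[OF spd_fine] by blast
  let ?d = "matrix_poly (sa_poly \<nu>) ?B *v (z - y)"
  have "energy_norm A (u - smoothed_prolongation \<nu> A Q P *v x)
      = energy_norm A (Q *v z + (- (Q *v ?d)))"
    by (simp add: smoothed_prolongation_error[OF u z])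
  also have "\<dots> \<le> energy_norm A (Q *v z) + energy_norm A (Q *v ?d)"
    using energy_norm_triangle[OF spd_A, of "Q *v z" "- (Q *v ?d)"]
    by (simp only: energy_norm_minus)
  also have "energy_norm A (Q *v ?d) \<le> norm (z - y) / real (2 * \<nu> + 1)"
    using energy_norm_sa_poly_le[OF spd_fine fine_operator_le]
    by (simp only: energy_norm_fine_operator)
  also have "\<dots> \<le> \<eta> * energy_norm A u / real (2 * \<nu> + 1)"
    by (intro divide_right_mono norm_fine_residual_le[OF u z]) simp
  also note energy_norm_fine_solution_le[OF z]
  finally have "energy_norm A (u - smoothed_prolongation \<nu> A Q P *v x)
               \<le> \<eta> * sqrt (spectral_norm (matrix_inv D)) * norm (A *v u)
                  + \<eta> / real (2 * \<nu> + 1) * energy_norm A u"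
    by simp
  then show ?thesis ..
qed

end


section \<open>Coarse-grid correction\<close>

text \<open>
  The equation for \<open>w\<close> makes the error \<open>A\<close>-orthogonal to the range of \<open>R\<close>.
\<close>

lemma Galerkin_optimal:
  fixes R :: "real^'c^'n"
  assumes A: "spd A"
    and w: "(transpose R ** A ** R) *v w = (transpose R ** A) *v u"
  shows "energy_norm A (u - R *v w) \<le> energy_norm A (u - R *v x)"
proof -
  let ?e = "u - R *v w"
  have "transpose R *v (A *v ?e) = 0"
    using w by (simp only: matrix_vector_mult_diff_distrib matrix_vector_mul_assoc[symmetric]
        right_minus_eq)
  then have "(R *v y) \<bullet> (A *v ?e) = 0" for y
    using inner_matrix_vector[of y "transpose R" "A *v ?e"]
    by (simp only: transpose_transpose inner_zero_right)
  then have "?e \<bullet> (A *v (R *v (w - x))) = 0"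
    by (simp only: spd_inner_swap[OF A, of ?e])
  from energy_norm_le_of_orthogonal[OF A this] show ?thesis
    by (simp add: matrix_vector_mult_diff_distrib)
qed


section \<open>Local bases on aggregates\<close>

lemma transpose_mult_entry:
  fixes P :: "real^'c^'n" and Q :: "real^'f^'n"
  shows "(transpose P ** D ** Q) $ j $ k = column j P \<bullet> (D *v column k Q)"
proof -
  have "(transpose P ** D ** Q) $ j $ k = axis j 1 \<bullet> ((transpose P ** D ** Q) *v axis k 1)"
    by (simp add: inner_axis' matrix_vector_mult_basis column_def)
  also have "\<dots> = (P *v axis j 1) \<bullet> (D *v (Q *v axis k 1))"
    by (simp only: matrix_vector_mul_assoc[symmetric] inner_matrix_vector[of _ "transpose P"]
        transpose_transpose)
  finally show ?thesis
    by (simp add: matrix_vector_mult_basis)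
qed

lemma inner_matrix_block:
  assumes "\<And>i. i \<notin> S \<Longrightarrow> v $ i = 0" and "\<And>i. i \<notin> S \<Longrightarrow> w $ i = 0"
  shows "v \<bullet> (matrix_block S S D *v w) = v \<bullet> (D *v w)"
  unfolding inner_vec_def matrix_vector_mult_def matrix_block_def
  using assms by (auto intro!: sum.cong)

lemma inner_diagonal_matrix_eq_0:
  assumes "diagonal_matrix D" and "S \<inter> T = {}"
    and "\<And>i. i \<notin> S \<Longrightarrow> v $ i = 0" and "\<And>i. i \<notin> T \<Longrightarrow> w $ i = 0"
  shows "v \<bullet> (D *v w) = 0"
proof -
  have "v $ i = 0 \<or> w $ i = 0" for i
    using assms(2-4) by blast
  then have "v $ i * (D $ i $ j * w $ j) = 0" for i j
    using assms(1) unfolding diagonal_matrix_def by (cases "i = j") auto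
  then show ?thesis
    by (simp only: inner_vec_def matrix_vector_mult_def sum_distrib_left inner_real_def
        vec_lambda_beta sum.neutral_const)
qed

text \<open>
  Columns that belong to different aggregates have disjoint supports, which a diagonal \<open>D\<close> does
  not couple. For columns of the same aggregate the local conditions apply, and restricting \<open>D\<close> to
  the aggregate does not change the inner products.
\<close>

lemma local_complement_basis_orthonormal:
  fixes D :: "real^'n^'n" and P :: "real^'c^'n" and Q :: "real^'f^'n"
  assumes D: "diagonal_matrix D"
    and part: "partition_on UNIV \<A>"
    and P: "block_diagonal \<A> c P"
    and basis: "local_complement_basis \<A> D c P f Q"
  shows "transpose P ** D ** Q = 0" and "transpose Q ** D ** Q = mat 1"
proof -
  have Q: "block_diagonal \<A> f Q"
    and local_orthonormal: "\<And>j k. f j = f k \<Longrightarrow>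
      column j Q \<bullet> (matrix_block (f k) (f k) D *v column k Q) = (if j = k then 1 else 0)"
    and local_span: "\<And>k. span {column j Q |j. f j = f k} = local_complement D c P (f k)"
    using basis unfolding local_complement_basis_def block_diagonal_def by auto
  have P0: "i \<notin> c j \<Longrightarrow> column j P $ i = 0" for i j
    using P by (simp add: block_diagonal_def column_def)
  have Q0: "i \<notin> f j \<Longrightarrow> column j Q $ i = 0" for i j
    using Q by (simp add: block_diagonal_def column_def)
  have disj: "S \<inter> T = {}" if "S \<in> \<A>" "T \<in> \<A>" "S \<noteq> T" for S T
    using part that by (auto simp: partition_on_def disjoint_def)
  have PQ: "column j P \<bullet> (D *v column k Q) = 0" for j k
  proof (cases "c j = f k")
    case False
    then have "c j \<inter> f k = {}"
      using P Q by (intro disj) (auto simp: block_diagonal_def)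
    then show ?thesis
      by (rule inner_diagonal_matrix_eq_0[OF D]) (auto simp: P0 Q0)
  next
    case True
    let ?R = "matrix_block (f k) {j. c j = f k} P"
    have "column k Q \<in> local_complement D c P (f k)"
      unfolding local_span[symmetric] by (rule span_base) blast
    then have "column k Q \<bullet> (matrix_block (f k) (f k) D *v (?R *v axis j 1)) = 0"
      unfolding local_complement_def by blast
    also have "?R *v axis j 1 = column j P"
      using True P unfolding matrix_vector_mult_basis
      by (auto simp: vec_eq_iff column_def matrix_block_def block_diagonal_def)
    also have "column k Q \<bullet> (matrix_block (f k) (f k) D *v column j P)
        = column k Q \<bullet> (D *v column j P)"
      by (rule inner_matrix_block) (use True P0[of _ j] Q0 in auto)
    also have "\<dots> = column j P \<bullet> (D *v column k Q)"
    proof -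
      have "transpose D = D"
        using D unfolding transpose_def vec_eq_iff diagonal_matrix_def
        by (metis vec_lambda_beta)
      then show ?thesis
        using inner_matrix_vector[of "column k Q" D "column j P"] by (simp only: inner_commute)
    qed
    finally show ?thesis .
  qed
  then show "transpose P ** D ** Q = 0"
    by (simp add: vec_eq_iff transpose_mult_entry)
  have "column j Q \<bullet> (D *v column k Q) = (if j = k then 1 else 0)" for j k
  proof (cases "f j = f k")
    case False
    then have "f j \<inter> f k = {}"
      using Q by (intro disj) (auto simp: block_diagonal_def)
    then have "column j Q \<bullet> (D *v column k Q) = 0"
      by (rule inner_diagonal_matrix_eq_0[OF D]) (auto simp: Q0)
    then show ?thesis
      using False by auto
  next
    case True
    have "column j Q \<bullet> (matrix_block (f k) (f k) D *v column k Q) = column j Q \<bullet> (D *v column k Q)"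
      by (rule inner_matrix_block) (use True Q0[of _ j] Q0 in auto)
    then show ?thesis
      using local_orthonormal[OF True] by simp
  qed
  then show "transpose Q ** D ** Q = mat 1"
    by (simp add: vec_eq_iff transpose_mult_entry mat_def)
qed


section \<open>The two-grid estimate\<close>

theorem corollary4p7:
  fixes A D :: "real^'n^'n"
    and \<A> :: "'n set set"
    and P Pt :: "real^'c^'n"
    and c :: "'c \<Rightarrow> 'n set"
    and Pperp :: "real^'f^'n"
    and f :: "'f \<Rightarrow> 'n set"
    and \<eta>\<^sub>w :: real
    and \<nu> :: nat
  assumes "spd A"
    and "spd D" and "diagonal_matrix D"
    and "\<forall>v. v \<bullet> (A *v v) \<le> v \<bullet> (D *v v)"
    and "partition_on UNIV \<A>"
    and "CARD('c) < CARD('n)" and "CARD('f) = CARD('n) - CARD('c)"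
    and "rank P = CARD('c)" and "block_diagonal \<A> c P"
    and "local_complement_basis \<A> D c P f Pperp"
    and "0 < \<eta>\<^sub>w" and "weak_approximation A D P \<eta>\<^sub>w"
    and "1 \<le> \<nu>" and "Pt = smoothed_prolongation \<nu> A Pperp P"
  shows "\<exists>\<eta>\<^sub>s. 0 \<le> \<eta>\<^sub>s \<and>
      \<eta>\<^sub>s \<le> spectral_norm D * spectral_norm (matrix_inv D) * \<eta>\<^sub>w\<^sup>2 \<and>
      (\<forall>u.
        (\<exists>!uc. (transpose Pt ** A ** Pt) *v uc = (transpose Pt ** A) *v u) \<and>
        (\<forall>uc. (transpose Pt ** A ** Pt) *v uc = (transpose Pt ** A) *v u \<longrightarrow>
          sqrt (spectral_norm A) * energy_norm A (u - Pt *v uc)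
            \<le> sqrt (spectral_norm D) * energy_norm A (u - Pt *v uc) \<and>
          sqrt (spectral_norm D) * energy_norm A (u - Pt *v uc)
            \<le> sqrt \<eta>\<^sub>s * norm (A *v u)
               + \<eta>\<^sub>w\<^sup>2 * sqrt (spectral_norm D) / real (2 * \<nu> + 1) * energy_norm A u)) \<and>
      (\<forall>K. spectral_norm D * spectral_norm (matrix_inv D) \<le> K \<longrightarrow> \<eta>\<^sub>s \<le> K * \<eta>\<^sub>w\<^sup>2)"
proof -
  note orth = local_complement_basis_orthonormal[OF assms(3,5,9,10)]
  have inner: "(M *v x) \<bullet> (D *v (Pperp *v y)) = x \<bullet> ((transpose M ** D ** Pperp) *v y)"
    for M :: "real^'m^'n" and x y
    by (simp only: matrix_vector_mul_assoc[symmetric] inner_matrix_vector[of _ "transpose M"]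
        transpose_transpose)
  interpret fine_coarse_splitting A D P Pperp \<eta>\<^sub>w
  proof
    show "x = 0" if "P *v x = 0" for x
      using that assms(8) matrix_nonfull_linear_equations_eq by blast
  qed (use assms orth in \<open>simp_all add: inner\<close>)
  define \<eta>\<^sub>s where "\<eta>\<^sub>s = spectral_norm D * spectral_norm (matrix_inv D) * \<eta>\<^sub>w\<^sup>2"
  let ?sD = "sqrt (spectral_norm D)"
  have "spectral_norm A \<le> spectral_norm D"
    by (rule spectral_norm_le_of_quadratic_form[OF spd_A])
       (rule order_trans[OF A_le_D quadratic_form_le_spectral[OF spd_D]])
  then have A_le: "sqrt (spectral_norm A) * energy_norm A v \<le> ?sD * energy_norm A v" for v
    by (intro mult_right_mono energy_norm_nonneg spd_A) simp
  have bound: "?sD * energy_norm A (u - Pt *v uc)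
      \<le> sqrt \<eta>\<^sub>s * norm (A *v u)
         + \<eta>\<^sub>w\<^sup>2 * ?sD / real (2 * \<nu> + 1) * energy_norm A u"
    if uc: "(transpose Pt ** A ** Pt) *v uc = (transpose Pt ** A) *v u" for u uc
  proof -
    have "CARD('c) + CARD('f) = CARD('n)"
      using assms(6,7) by simp
    then obtain x where x: "energy_norm A (u - Pt *v x)
        \<le> \<eta>\<^sub>w * sqrt (spectral_norm (matrix_inv D)) * norm (A *v u)
           + \<eta>\<^sub>w / real (2 * \<nu> + 1) * energy_norm A u"
      using smoothed_prolongation_approximation[of u \<nu>] assms(14) by blast
    have "\<eta>\<^sub>w \<le> \<eta>\<^sub>w\<^sup>2"
      using eta_ge_1 by (simp add: power2_eq_square)
    then have "\<eta>\<^sub>w / real (2 * \<nu> + 1) * energy_norm A u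
        \<le> \<eta>\<^sub>w\<^sup>2 / real (2 * \<nu> + 1) * energy_norm A u"
      by (intro mult_right_mono divide_right_mono energy_norm_nonneg spd_A) simp_all
    with x Galerkin_optimal[OF spd_A uc, of x]
    have "energy_norm A (u - Pt *v uc)
        \<le> \<eta>\<^sub>w * sqrt (spectral_norm (matrix_inv D)) * norm (A *v u)
           + \<eta>\<^sub>w\<^sup>2 / real (2 * \<nu> + 1) * energy_norm A u"
      by linarith
    then have "?sD * energy_norm A (u - Pt *v uc)
        \<le> ?sD * (\<eta>\<^sub>w * sqrt (spectral_norm (matrix_inv D)) * norm (A *v u)
           + \<eta>\<^sub>w\<^sup>2 / real (2 * \<nu> + 1) * energy_norm A u)"
      by (rule mult_left_mono) simp
    also have "sqrt \<eta>\<^sub>s = ?sD * (\<eta>\<^sub>w * sqrt (spectral_norm (matrix_inv D)))"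
      using assms(11) by (simp add: \<eta>\<^sub>s_def real_sqrt_mult)
    ultimately show ?thesis
      by (simp add: algebra_simps)
  qed
  have "spd (transpose Pt ** A ** Pt)"
    unfolding fine_operator_def[symmetric]
    by (rule spd_fine_operator[OF spd_A]) (use smoothed_prolongation_injective assms(14) in blast)
  then have "\<exists>!uc. (transpose Pt ** A ** Pt) *v uc = (transpose Pt ** A) *v u" for u
    by (rule spd_ex1_solution)
  moreover have "\<eta>\<^sub>s \<le> K * \<eta>\<^sub>w\<^sup>2" if "spectral_norm D * spectral_norm (matrix_inv D) \<le> K" for K
    unfolding \<eta>\<^sub>s_def by (intro mult_right_mono that) simp
  moreover have "0 \<le> \<eta>\<^sub>s"
    by (simp add: \<eta>\<^sub>s_def)
  ultimately show ?thesis
    using A_le bound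
    by (intro exI[of _ \<eta>\<^sub>s] conjI allI impI) (simp_all only: \<eta>\<^sub>s_def[symmetric] order_refl)
qed

end
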